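(* Let $\mathcal{B}$ be a separable complex Banach space and let $\phi:\mathbb{D}\to\mathbf{L}(\mathcal{B},\mathcal{B}^* )$ be a function analytic in the open unit disk $\mathbb{D}$ such that $$\phi(z)+\phi(z)^*\big|_{\mathcal{B}}\ge 0,\quad z\in\mathbb{D}.$$ Then there exist an increasing $\mathbf{L}(\mathcal{B},\mathcal{B}^* )$-valued function $M(t)$, $t\in[0,2\pi]$, and a purely imaginary operator $D$ from $\mathcal{B}$ into $\mathcal{B}^*$ (that is, $D+D^*\big|_{\mathcal{B}}=0$) such that $$\phi(z)=D+\int_0^{2\pi}\frac{e^{it}+z}{e^{it}-z}\,dM(t),\quad z\in\mathbb{D},$$ where the integral is defined in the weak sense. Furthermore, the kernel $$k_\phi(z,w)=\frac{\phi(z)+\phi(w)^*\big|_{\mathcal{B}}}{2(1-zw^* )}$$ is positive in $\mathbb{D}$.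
   Context: $z^*$ denotes the complex conjugate of $z\in\mathbb{C}$. For a complex Banach space $\mathcal{B}$, $\mathcal{B}^*$ denotes its conjugate dual, i.e. the space of bounded anti-linear functionals on $\mathcal{B}$, and $\langle b_*,b\rangle_{\mathcal{B}}:=b_*(b)$ for $b\in\mathcal{B}$, $b_*\in\mathcal{B}^*$. $\mathbf{L}(\mathcal{B},\mathcal{B}^* )$ is the space of bounded linear operators from $\mathcal{B}$ to $\mathcal{B}^*$. For $A\in\mathbf{L}(\mathcal{B},\mathcal{B}^* )$, $A^*\big|_{\mathcal{B}}\in\mathbf{L}(\mathcal{B},\mathcal{B}^* )$ is the restriction of the adjoint $A^*:\mathcal{B}^{**}\to\mathcal{B}^*$ to $\mathcal{B}$ (embedded in $\mathcal{B}^{**}$ by $\langle\tau(b),b_*\rangle_{\mathcal{B}^*}=\overline{\langle b_*,b\rangle_{\mathcal{B}}}$); thus $\langle A^*\big|_{\mathcal{B}}c,b\rangle_{\mathcal{B}}=\overline{\langle Ab,c\rangle_{\mathcal{B}}}$ for $b,c\in\mathcal{B}$. An operator $A\in\mathbf{L}(\mathcal{B},\mathcal{B}^* )$ is positive, written $A\ge 0$, if $\langle Ab,b\rangle_{\mathcal{B}}\ge 0$ for all $b\in\mathcal{B}$; $A\le B$ means $B-A\ge 0$. A function $M:[0,2\pi]\to\mathbf{L}(\mathcal{B},\mathcal{B}^* )$ is increasing if $M(t_2)-M(t_1)\ge 0$ whenever $0\le t_1\le t_2\le 2\pi$. That the integral is defined in the weak sense means that for all $b,c\in\mathcal{B}$,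 $\langle\phi(z)b,c\rangle_{\mathcal{B}}=\langle Db,c\rangle_{\mathcal{B}}+\int_0^{2\pi}\frac{e^{it}+z}{e^{it}-z}\,d\langle M(t)b,c\rangle_{\mathcal{B}}$, a scalar Stieltjes integral. An $\mathbf{L}(\mathcal{B},\mathcal{B}^* )$-valued kernel $K(z,w)$ on $\Omega\times\Omega$ is called positive (in $\Omega$) if for every $n$, all $z_1,\dots,z_n\in\Omega$ and all $b_1,\dots,b_n\in\mathcal{B}$ one has $\sum_{i,j=1}^n\langle K(z_i,z_j)b_j,b_i\rangle_{\mathcal{B}}\ge 0$. *)

theory Defs
  imports "HOL-Analysis.Analysis"
begin

section \<open>Complex Banach spaces\<close>

class scaleC =
  fixes scaleC :: "complex \<Rightarrow> 'a \<Rightarrow> 'a"  (infixr \<open>*\<^sub>C\<close> 75)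

class complex_vector = real_vector + scaleC +
  assumes scaleC_add_right: "a *\<^sub>C (x + y) = a *\<^sub>C x + a *\<^sub>C y"
    and scaleC_add_left: "(a + b) *\<^sub>C x = a *\<^sub>C x + b *\<^sub>C x"
    and scaleC_scaleC: "a *\<^sub>C (b *\<^sub>C x) = (a * b) *\<^sub>C x"
    and scaleC_one: "1 *\<^sub>C x = x"
    and scaleR_scaleC: "r *\<^sub>R x = complex_of_real r *\<^sub>C x"

class complex_normed_vector = complex_vector + real_normed_vector +
  assumes norm_scaleC: "norm (a *\<^sub>C x) = cmod a * norm x"

class complex_banach = complex_normed_vector + banach

instantiation complex :: complex_banach
begin

definition scaleC_complex :: "complex \<Rightarrow> complex \<Rightarrow> complex"
  where "scaleC_complex a x = a * x"

instance
  by standard (auto simp: scaleC_complex_def algebra_simps norm_mult scaleR_conv_of_real)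

end


section \<open>The conjugate dual\<close>

text \<open>
  Elements are represented by real-linear bounded maps that are moreover conjugate homogeneous;
  the norm, inherited from \<open>\<Rightarrow>\<^sub>L\<close>, is then the usual functional norm.
\<close>

typedef (overloaded) 'a conj_dual =
  "{f :: 'a::complex_normed_vector \<Rightarrow>\<^sub>L complex.
      \<forall>c x. blinfun_apply f (c *\<^sub>C x) = cnj c * blinfun_apply f x}"
  by (rule exI[of _ 0]) simp

setup_lifting type_definition_conj_dual

lift_definition pairing :: "'a::complex_normed_vector conj_dual \<Rightarrow> 'a \<Rightarrow> complex"
  is blinfun_apply .

instantiation conj_dual :: (complex_normed_vector) real_normed_vector
begin

lift_definition zero_conj_dual :: "'a conj_dual" is 0
  by simp
lift_definition plus_conj_dual :: "'a conj_dual \<Rightarrow> 'a conj_dual \<Rightarrow> 'a conj_dual" is "(+)"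
  by (simp add: blinfun.add_left algebra_simps)
lift_definition minus_conj_dual :: "'a conj_dual \<Rightarrow> 'a conj_dual \<Rightarrow> 'a conj_dual" is "(-)"
  by (simp add: blinfun.diff_left algebra_simps)
lift_definition uminus_conj_dual :: "'a conj_dual \<Rightarrow> 'a conj_dual" is uminus
  by (simp add: blinfun.minus_left)
lift_definition scaleR_conj_dual :: "real \<Rightarrow> 'a conj_dual \<Rightarrow> 'a conj_dual" is scaleR
  by (simp add: blinfun.scaleR_left)
lift_definition norm_conj_dual :: "'a conj_dual \<Rightarrow> real" is norm .

definition dist_conj_dual :: "'a conj_dual \<Rightarrow> 'a conj_dual \<Rightarrow> real"
  where "dist_conj_dual f g = norm (f - g)"
definition sgn_conj_dual :: "'a conj_dual \<Rightarrow> 'a conj_dual"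
  where "sgn_conj_dual f = inverse (norm f) *\<^sub>R f"
definition uniformity_conj_dual :: "('a conj_dual \<times> 'a conj_dual) filter"
  where [code del]: "uniformity_conj_dual = (INF e\<in>{0 <..}. principal {(f, g). dist f g < e})"
definition open_conj_dual :: "'a conj_dual set \<Rightarrow> bool"
  where [code del]:
    "open_conj_dual S = (\<forall>f\<in>S. \<forall>\<^sub>F (f', g) in uniformity. f' = f \<longrightarrow> g \<in> S)"

instance
proof
  fix f g h :: "'a conj_dual" and r s :: real
  show "f + g + h = f + (g + h)" "f + g = g + f" "0 + f = f" "- f + f = 0" "f - g = f + - g"
    by (transfer; simp)+
  show "r *\<^sub>R (f + g) = r *\<^sub>R f + r *\<^sub>R g" "(r + s) *\<^sub>R f = r *\<^sub>R f + s *\<^sub>R f"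
    "r *\<^sub>R s *\<^sub>R f = (r * s) *\<^sub>R f" "1 *\<^sub>R f = f"
    by (transfer; simp add: scaleR_add_right scaleR_add_left)+
  show "dist f g = norm (f - g)" by (rule dist_conj_dual_def)
  show "sgn f = inverse (norm f) *\<^sub>R f" by (rule sgn_conj_dual_def)
  show "(norm f = 0) = (f = 0)" "norm (f + g) \<le> norm f + norm g"
    "norm (r *\<^sub>R f) = \<bar>r\<bar> * norm f"
    by (transfer; simp add: norm_triangle_ineq)+
qed (rule uniformity_conj_dual_def open_conj_dual_def)+

end

instantiation conj_dual :: (complex_normed_vector) complex_normed_vector
begin

lift_definition scaleC_conj_dual :: "complex \<Rightarrow> 'a conj_dual \<Rightarrow> 'a conj_dual"
  is "\<lambda>a f. blinfun_compose (blinfun_mult_right a) f"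
  by simp

instance
proof
  fix f g :: "'a conj_dual" and r :: real and a b :: complex
  show "a *\<^sub>C (f + g) = a *\<^sub>C f + a *\<^sub>C g" "(a + b) *\<^sub>C f = a *\<^sub>C f + b *\<^sub>C f"
    "a *\<^sub>C b *\<^sub>C f = (a * b) *\<^sub>C f" "1 *\<^sub>C f = f" "r *\<^sub>R f = complex_of_real r *\<^sub>C f"
    by (transfer; auto intro!: blinfun_eqI simp: blinfun.bilinear_simps algebra_simps
        scaleR_conv_of_real)+
  show "norm (a *\<^sub>C f) = cmod a * norm f"
  proof transfer
    fix a :: complex and f :: "'a \<Rightarrow>\<^sub>L complex"
    show "norm (blinfun_mult_right a o\<^sub>L f) = cmod a * norm f"
    proof (cases "a = 0")
      case True
      then have "blinfun_mult_right a o\<^sub>L f = 0" by (auto intro!: blinfun_eqI)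
      then show ?thesis using True by simp
    next
      case False
      have le: "norm (blinfun_mult_right c o\<^sub>L h) \<le> cmod c * norm h"
        for c and h :: "'a \<Rightarrow>\<^sub>L complex"
        by (rule norm_blinfun_bound)
          (auto simp: norm_mult mult.assoc intro!: mult_left_mono norm_blinfun)
      have "f = blinfun_mult_right (inverse a) o\<^sub>L (blinfun_mult_right a o\<^sub>L f)"
        using False by (auto intro!: blinfun_eqI)
      then have "norm f \<le> cmod (inverse a) * norm (blinfun_mult_right a o\<^sub>L f)"
        using le by metis
      then have "cmod a * norm f \<le> norm (blinfun_mult_right a o\<^sub>L f)"
        using False by (simp add: norm_inverse norm_divide field_simps)
      with le[of a f] show ?thesis by simp
    qed
  qed
qed

end

lemma conj_dual_eqI: "(\<And>x. pairing f x = pairing g x) \<Longrightarrow> f = g"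
  by transfer (rule blinfun_eqI)

lemma pairing_simps [simp]:
  "pairing 0 x = 0"
  "pairing (f + g) x = pairing f x + pairing g x"
  "pairing (f - g) x = pairing f x - pairing g x"
  "pairing (- f) x = - pairing f x"
  "pairing (r *\<^sub>R f) x = r *\<^sub>R pairing f x"
  "pairing (a *\<^sub>C f) x = a * pairing f x"
  "pairing f 0 = 0"
  "pairing f (x + y) = pairing f x + pairing f y"
  "pairing f (x - y) = pairing f x - pairing f y"
  "pairing f (- x) = - pairing f x"
  "pairing f (r *\<^sub>R x) = r *\<^sub>R pairing f x"
  "pairing f (a *\<^sub>C x) = cnj a * pairing f x"
  by (transfer; simp add: blinfun.bilinear_simps)+

lemma norm_pairing: "cmod (pairing f x) \<le> norm f * norm x"
  by transfer (rule norm_blinfun)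

lemma norm_conj_dual_bound:
  "0 \<le> C \<Longrightarrow> (\<And>x. cmod (pairing f x) \<le> C * norm x) \<Longrightarrow> norm f \<le> C"
  by transfer (rule norm_blinfun_bound)

lemma pairing_Abs_conj_dual:
  assumes "bounded_linear f" "\<And>a x. f (a *\<^sub>C x) = cnj a * f x"
  shows "pairing (Abs_conj_dual (Blinfun f)) x = f x"
  using assms by (simp add: pairing.rep_eq Abs_conj_dual_inverse bounded_linear_Blinfun_apply)


section \<open>Bounded complex-linear operators\<close>

lemma bounded_linear_scaleC: "bounded_linear (\<lambda>x::'a::complex_normed_vector. a *\<^sub>C x)"
proof (rule bounded_linear_intro[where K = "cmod a"])
  show "a *\<^sub>C (x + y) = a *\<^sub>C x + a *\<^sub>C y" for x y :: 'a
    by (rule scaleC_add_right)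
  show "a *\<^sub>C (r *\<^sub>R x) = r *\<^sub>R (a *\<^sub>C x)" for r and x :: 'a
    unfolding scaleR_scaleC scaleC_scaleC by (simp add: mult.commute)
  show "norm (a *\<^sub>C x) \<le> norm x * cmod a" for x :: 'a
    by (simp add: norm_scaleC)
qed

lemma scaleC_zero [simp]: "a *\<^sub>C (0::'a::complex_normed_vector) = 0"
  by (rule linear_0[OF bounded_linear.linear[OF bounded_linear_scaleC]])

lemma scaleC_minus: "a *\<^sub>C (- x) = - (a *\<^sub>C (x::'a::complex_normed_vector))"
  by (rule linear_neg[OF bounded_linear.linear[OF bounded_linear_scaleC]])

lemma scaleC_diff: "a *\<^sub>C (x - y) = a *\<^sub>C x - a *\<^sub>C (y::'a::complex_normed_vector)"
  by (rule linear_diff[OF bounded_linear.linear[OF bounded_linear_scaleC]])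

typedef (overloaded) ('a, 'b) cblinfun =
  "{A :: 'a::complex_normed_vector \<Rightarrow>\<^sub>L 'b::complex_normed_vector.
      \<forall>c x. blinfun_apply A (c *\<^sub>C x) = c *\<^sub>C blinfun_apply A x}"
  by (rule exI[of _ 0]) simp

setup_lifting type_definition_cblinfun

lift_definition cblinfun_apply ::
  "('a::complex_normed_vector, 'b::complex_normed_vector) cblinfun \<Rightarrow> 'a \<Rightarrow> 'b"
  is blinfun_apply .

lift_definition blinfun_scaleC :: "complex \<Rightarrow> 'a::complex_normed_vector \<Rightarrow>\<^sub>L 'a" is scaleC
  by (rule bounded_linear_scaleC)

instantiation cblinfun :: (complex_normed_vector, complex_normed_vector) real_normed_vector
begin

lift_definition zero_cblinfun :: "('a, 'b) cblinfun" is 0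
  by simp
lift_definition plus_cblinfun :: "('a, 'b) cblinfun \<Rightarrow> ('a, 'b) cblinfun \<Rightarrow> ('a, 'b) cblinfun"
  is "(+)"
  by (simp add: blinfun.add_left scaleC_add_right)
lift_definition minus_cblinfun :: "('a, 'b) cblinfun \<Rightarrow> ('a, 'b) cblinfun \<Rightarrow> ('a, 'b) cblinfun"
  is "(-)"
  by (simp add: blinfun.diff_left scaleC_diff)
lift_definition uminus_cblinfun :: "('a, 'b) cblinfun \<Rightarrow> ('a, 'b) cblinfun" is uminus
  by (simp add: blinfun.minus_left scaleC_minus)
lift_definition scaleR_cblinfun :: "real \<Rightarrow> ('a, 'b) cblinfun \<Rightarrow> ('a, 'b) cblinfun" is scaleR
  by (simp add: blinfun.scaleR_left scaleR_scaleC scaleC_scaleC mult.commute)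
lift_definition norm_cblinfun :: "('a, 'b) cblinfun \<Rightarrow> real" is norm .

definition dist_cblinfun :: "('a, 'b) cblinfun \<Rightarrow> ('a, 'b) cblinfun \<Rightarrow> real"
  where "dist_cblinfun A B = norm (A - B)"
definition sgn_cblinfun :: "('a, 'b) cblinfun \<Rightarrow> ('a, 'b) cblinfun"
  where "sgn_cblinfun A = inverse (norm A) *\<^sub>R A"
definition uniformity_cblinfun :: "(('a, 'b) cblinfun \<times> ('a, 'b) cblinfun) filter"
  where [code del]: "uniformity_cblinfun = (INF e\<in>{0 <..}. principal {(A, B). dist A B < e})"
definition open_cblinfun :: "('a, 'b) cblinfun set \<Rightarrow> bool"
  where [code del]:
    "open_cblinfun S = (\<forall>A\<in>S. \<forall>\<^sub>F (A', B) in uniformity. A' = A \<longrightarrow> B \<in> S)"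

instance
proof
  fix f g h :: "('a, 'b) cblinfun" and r s :: real
  show "f + g + h = f + (g + h)" "f + g = g + f" "0 + f = f" "- f + f = 0" "f - g = f + - g"
    by (transfer; simp)+
  show "r *\<^sub>R (f + g) = r *\<^sub>R f + r *\<^sub>R g" "(r + s) *\<^sub>R f = r *\<^sub>R f + s *\<^sub>R f"
    "r *\<^sub>R s *\<^sub>R f = (r * s) *\<^sub>R f" "1 *\<^sub>R f = f"
    by (transfer; simp add: scaleR_add_right scaleR_add_left)+
  show "dist f g = norm (f - g)" by (rule dist_cblinfun_def)
  show "sgn f = inverse (norm f) *\<^sub>R f" by (rule sgn_cblinfun_def)
  show "(norm f = 0) = (f = 0)" "norm (f + g) \<le> norm f + norm g"
    "norm (r *\<^sub>R f) = \<bar>r\<bar> * norm f"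
    by (transfer; simp add: norm_triangle_ineq)+
qed (rule uniformity_cblinfun_def open_cblinfun_def)+

end

instantiation cblinfun :: (complex_normed_vector, complex_normed_vector) complex_normed_vector
begin

lift_definition scaleC_cblinfun :: "complex \<Rightarrow> ('a, 'b) cblinfun \<Rightarrow> ('a, 'b) cblinfun"
  is "\<lambda>a A. blinfun_compose (blinfun_scaleC a) A"
  by (simp add: blinfun_scaleC.rep_eq scaleC_scaleC mult.commute)

instance
proof
  fix f g :: "('a, 'b) cblinfun" and r :: real and a b :: complex
  show "a *\<^sub>C (f + g) = a *\<^sub>C f + a *\<^sub>C g" "(a + b) *\<^sub>C f = a *\<^sub>C f + b *\<^sub>C f"
    "a *\<^sub>C b *\<^sub>C f = (a * b) *\<^sub>C f" "1 *\<^sub>C f = f" "r *\<^sub>R f = complex_of_real r *\<^sub>C f"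
    by (transfer; rule blinfun_eqI; simp add: plus_blinfun.rep_eq scaleR_blinfun.rep_eq
        blinfun_scaleC.rep_eq scaleC_add_right scaleC_add_left scaleC_scaleC scaleC_one
        scaleR_scaleC)+
  show "norm (a *\<^sub>C f) = cmod a * norm f"
  proof transfer
    fix a :: complex and f :: "'a \<Rightarrow>\<^sub>L 'b"
    show "norm (blinfun_scaleC a o\<^sub>L f) = cmod a * norm f"
    proof (cases "a = 0")
      case True
      then have "blinfun_scaleC a o\<^sub>L f = 0"
        by (intro blinfun_eqI) (metis blinfun_apply_blinfun_compose blinfun_scaleC.rep_eq
            mult_zero_left norm_eq_zero norm_scaleC norm_zero zero_blinfun.rep_eq)
      then show ?thesis using True by simp
    next
      case False
      have le: "norm (blinfun_scaleC c o\<^sub>L h) \<le> cmod c * norm h"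
        for c and h :: "'a \<Rightarrow>\<^sub>L 'b"
        by (rule norm_blinfun_bound)
          (auto simp: norm_scaleC blinfun_scaleC.rep_eq mult.assoc
            intro!: mult_left_mono norm_blinfun)
      have "f = blinfun_scaleC (inverse a) o\<^sub>L (blinfun_scaleC a o\<^sub>L f)"
        using False
        by (auto intro!: blinfun_eqI simp: blinfun_scaleC.rep_eq scaleC_scaleC scaleC_one)
      then have "norm f \<le> cmod (inverse a) * norm (blinfun_scaleC a o\<^sub>L f)"
        using le by metis
      then have "cmod a * norm f \<le> norm (blinfun_scaleC a o\<^sub>L f)"
        using False by (simp add: norm_inverse norm_divide field_simps)
      with le[of a f] show ?thesis by simp
    qed
  qed
qed

end

lemma cblinfun_eqI: "(\<And>x. cblinfun_apply A x = cblinfun_apply B x) \<Longrightarrow> A = B"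
  by transfer (rule blinfun_eqI)

lemma cblinfun_apply_simps [simp]:
  "cblinfun_apply 0 x = 0"
  "cblinfun_apply (A + B) x = cblinfun_apply A x + cblinfun_apply B x"
  "cblinfun_apply (A - B) x = cblinfun_apply A x - cblinfun_apply B x"
  "cblinfun_apply (- A) x = - cblinfun_apply A x"
  "cblinfun_apply (r *\<^sub>R A) x = r *\<^sub>R cblinfun_apply A x"
  "cblinfun_apply (a *\<^sub>C A) x = a *\<^sub>C cblinfun_apply A x"
  "cblinfun_apply A 0 = 0"
  "cblinfun_apply A (x + y) = cblinfun_apply A x + cblinfun_apply A y"
  "cblinfun_apply A (x - y) = cblinfun_apply A x - cblinfun_apply A y"
  "cblinfun_apply A (- x) = - cblinfun_apply A x"
  "cblinfun_apply A (r *\<^sub>R x) = r *\<^sub>R cblinfun_apply A x"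
  "cblinfun_apply A (a *\<^sub>C x) = a *\<^sub>C cblinfun_apply A x"
  by (transfer; simp add: blinfun.bilinear_simps blinfun_scaleC.rep_eq)+

lemma norm_cblinfun: "norm (cblinfun_apply A x) \<le> norm A * norm x"
  by transfer (rule norm_blinfun)

lemma cblinfun_apply_Abs_cblinfun:
  assumes "bounded_linear f" "\<And>a x. f (a *\<^sub>C x) = a *\<^sub>C f x"
  shows "cblinfun_apply (Abs_cblinfun (Blinfun f)) x = f x"
  using assms by (simp add: cblinfun_apply.rep_eq Abs_cblinfun_inverse bounded_linear_Blinfun_apply)

lift_definition cblinfun_compose ::
  "('b::complex_normed_vector, 'c::complex_normed_vector) cblinfun \<Rightarrow>
   ('a::complex_normed_vector, 'b) cblinfun \<Rightarrow> ('a, 'c) cblinfun"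
  is blinfun_compose
  by simp

lemma cblinfun_compose_apply [simp]:
  "cblinfun_apply (cblinfun_compose A B) x = cblinfun_apply A (cblinfun_apply B x)"
  by transfer simp


section \<open>Adjoints\<close>

lift_definition conj_dual_compose ::
  "'b::complex_normed_vector conj_dual \<Rightarrow> ('a::complex_normed_vector, 'b) cblinfun \<Rightarrow> 'a conj_dual"
  is blinfun_compose
  by simp

lemma pairing_conj_dual_compose [simp]:
  "pairing (conj_dual_compose f A) x = pairing f (cblinfun_apply A x)"
  by transfer simp

definition cadjoint ::
  "('a::complex_normed_vector, 'b::complex_normed_vector) cblinfun \<Rightarrow>
   ('b conj_dual, 'a conj_dual) cblinfun"
  where "cadjoint A = Abs_cblinfun (Blinfun (\<lambda>f. conj_dual_compose f A))"

lemma cadjoint_apply [simp]: "cblinfun_apply (cadjoint A) f = conj_dual_compose f A"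
  unfolding cadjoint_def
proof (rule cblinfun_apply_Abs_cblinfun)
  show "bounded_linear (\<lambda>f. conj_dual_compose f A)"
  proof (rule bounded_linear_intro[where K = "norm A"])
    show "norm (conj_dual_compose f A) \<le> norm f * norm A" for f
    proof (rule norm_conj_dual_bound)
      show "cmod (pairing (conj_dual_compose f A) x) \<le> norm f * norm A * norm x" for x
        using norm_pairing[of f "cblinfun_apply A x"] norm_cblinfun[of A x]
        by (simp add: mult.assoc) (meson mult_left_mono norm_ge_zero order_trans)
    qed simp
  qed (auto intro!: conj_dual_eqI)
qed (auto intro!: conj_dual_eqI)

text \<open>
  The canonical embedding of a space into its conjugate bidual. The conjugation makes the
  image of \<^term>\<open>x\<close> anti-linear in the functional and the embedding linear in \<^term>\<open>x\<close>.
\<close>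

definition bidual_embed :: "('a::complex_normed_vector, 'a conj_dual conj_dual) cblinfun"
  where "bidual_embed =
    Abs_cblinfun (Blinfun (\<lambda>x. Abs_conj_dual (Blinfun (\<lambda>f. cnj (pairing f x)))))"

lemma pairing_bidual_embed [simp]:
  fixes x :: "'a::complex_normed_vector"
  shows "pairing (cblinfun_apply bidual_embed x) f = cnj (pairing f x)"
proof -
  define e where "e x = Abs_conj_dual (Blinfun (\<lambda>f. cnj (pairing f x)))" for x :: 'a
  have e: "pairing (e x) f = cnj (pairing f x)" for x f
    unfolding e_def
  proof (rule pairing_Abs_conj_dual)
    show "bounded_linear (\<lambda>f. cnj (pairing f x))"
      by (rule bounded_linear_intro[where K = "norm x"]) (auto simp: norm_pairing)
  qed simp
  have "bounded_linear e"
  proof (rule bounded_linear_intro[where K = 1])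
    show "norm (e x) \<le> norm x * 1" for x
    proof (rule norm_conj_dual_bound)
      show "cmod (pairing (e x) f) \<le> norm x * 1 * norm f" for f
        using norm_pairing[of f x] by (simp add: e mult.commute)
    qed simp
  qed (rule conj_dual_eqI, simp add: e)+
  then have "cblinfun_apply bidual_embed x = e x"
    unfolding bidual_embed_def e_def[abs_def, symmetric]
    by (rule cblinfun_apply_Abs_cblinfun) (auto intro!: conj_dual_eqI simp: e)
  then show ?thesis by (simp add: e)
qed

text \<open>
  For \<open>A\<close> from a space into its conjugate dual, the adjoint acts from the bidual to the dual;
  this is its restriction to the (embedded) original space.
\<close>

definition restricted_adjoint ::
  "('a::complex_normed_vector, 'a conj_dual) cblinfun \<Rightarrow> ('a, 'a conj_dual) cblinfun"
  where "restricted_adjoint A = cblinfun_compose (cadjoint A) bidual_embed"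

lemma pairing_restricted_adjoint:
  "pairing (cblinfun_apply (restricted_adjoint A) c) b = cnj (pairing (cblinfun_apply A b) c)"
  by (simp add: restricted_adjoint_def)


section \<open>Positivity, analyticity and weak Stieltjes integrals\<close>

definition positive_op :: "('a::complex_normed_vector, 'a conj_dual) cblinfun \<Rightarrow> bool"
  where "positive_op A \<longleftrightarrow> (\<forall>b. pairing (cblinfun_apply A b) b \<in> \<real>\<^sub>\<ge>\<^sub>0)"

definition increasing_op_on ::
  "real set \<Rightarrow> (real \<Rightarrow> ('a::complex_normed_vector, 'a conj_dual) cblinfun) \<Rightarrow> bool"
  where "increasing_op_on T M \<longleftrightarrow>
    (\<forall>t1\<in>T. \<forall>t2\<in>T. t1 \<le> t2 \<longrightarrow> positive_op (M t2 - M t1))"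

definition positive_kernel_on ::
  "complex set \<Rightarrow>
   (complex \<Rightarrow> complex \<Rightarrow> ('a::complex_normed_vector, 'a conj_dual) cblinfun) \<Rightarrow> bool"
  where "positive_kernel_on \<Omega> K \<longleftrightarrow>
    (\<forall>(n::nat) z b. (\<forall>i<n. z i \<in> \<Omega>) \<longrightarrow>
      (\<Sum>i<n. \<Sum>j<n. pairing (cblinfun_apply (K (z i) (z j)) (b j)) (b i)) \<in> \<real>\<^sub>\<ge>\<^sub>0)"

text \<open>Complex differentiability in norm at every point; meant for open \<^term>\<open>S\<close>.\<close>

definition vector_holomorphic_on ::
  "(complex \<Rightarrow> 'a::complex_normed_vector) \<Rightarrow> complex set \<Rightarrow> bool"
  where "vector_holomorphic_on f S \<longleftrightarrow>
    (\<forall>z\<in>S. \<exists>f'. (f has_derivative (\<lambda>h. h *\<^sub>C f')) (at z))"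

text \<open>
  The Riemann--Stieltjes integral of \<^term>\<open>f\<close> against \<^term>\<open>g\<close> over \<^term>\<open>{a..b}\<close>, as the limit
  of the sums of \<open>f x * (g v - g u)\<close> over tagged partitions into intervals \<open>{u..v}\<close> as the mesh
  tends to \<open>0\<close>. No one-sided continuity of \<^term>\<open>g\<close> is required, and jumps of \<^term>\<open>g\<close> at
  \<^term>\<open>a\<close> and \<^term>\<open>b\<close> count. Degenerate intervals, which a tagged division may contain,
  contribute nothing.
\<close>

definition has_stieltjes_integral ::
  "(real \<Rightarrow> complex) \<Rightarrow> (real \<Rightarrow> complex) \<Rightarrow> complex \<Rightarrow> real \<Rightarrow> real \<Rightarrow> bool"
  where "has_stieltjes_integral f g I a b \<longleftrightarrow>
    (\<forall>e>0. \<exists>d>0. \<forall>p. p tagged_division_of {a..b} \<and> (\<lambda>x. ball x d) fine p \<longrightarrow>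
      cmod ((\<Sum>(x, K)\<in>p. f x * (g (Sup K) - g (Inf K))) - I) < e)"

definition has_weak_stieltjes_integral ::
  "(real \<Rightarrow> complex) \<Rightarrow> (real \<Rightarrow> ('a::complex_normed_vector, 'a conj_dual) cblinfun) \<Rightarrow>
   ('a, 'a conj_dual) cblinfun \<Rightarrow> real \<Rightarrow> real \<Rightarrow> bool"
  where "has_weak_stieltjes_integral f M I a b \<longleftrightarrow>
    (\<forall>x y. has_stieltjes_integral f (\<lambda>t. pairing (cblinfun_apply (M t) x) y)
      (pairing (cblinfun_apply I x) y) a b)"

end

theory Submission
  imports Defs "HOL-Complex_Analysis.Cauchy_Integral_Formula"
begin

text \<open>
  For \<open>r < 1\<close> the dilated function \<open>\<lambda>z. \<phi> (r * z)\<close> is analytic across the unit circle, and there the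
  representation is the classical Schwarz formula (\<open>schwarz_formula\<close>): its measure has the density
  \<open>(\<phi> (r * e) + adjoint) / (4 * pi)\<close> at \<open>e = cis s\<close>, a positive operator. All that remains is to let
  \<open>r\<close> tend to 1.

  By the mean value property the diagonal total masses depend only on \<open>\<phi> 0\<close>, and the
  Cauchy--Schwarz inequality (\<open>positive_op_Cauchy_Schwarz\<close>) bounds the off-diagonal measures by the
  diagonal ones. So the numbers \<open>mass r t b c\<close>, the values of the distribution functions of the
  dilated measures as sesquilinear forms, lie in discs that do not depend on \<open>r\<close>. Tychonoff's
  theorem (\<open>pointwise_cluster_filter\<close>) yields a filter finer than \<open>r \<rightarrow> 1\<close> along which all of them
  converge simultaneously, for all \<open>t\<close>, \<open>b\<close> and \<open>c\<close>; the limits are the values of an increasing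
  operator function \<open>M\<close>. Since the total variations are uniformly bounded, Stieltjes sums
  approximate the integrals of the Herglotz kernel uniformly in \<open>r\<close>, so the integrals against \<open>M\<close>
  exist and are the limits of those against the dilated measures
  (\<open>has_stieltjes_integral_limit\<close>). The latter are the values of \<open>\<phi> (r * z) - D\<close>, which converge
  to \<open>\<phi> z - D\<close>.

  The positivity of the kernel also comes from the dilated measures: the sum of two Herglotz
  kernels factors (\<open>cauchy_kernel_factorization\<close>), so the kernel of the dilated function is a
  Gram-type integral of positive forms, and positivity is kept as \<open>r\<close> tends to 1.
\<close>

section \<open>The Schwarz formula on the unit circle\<close>

lemma cauchy_formula_unit_circle:
  fixes G :: "complex \<Rightarrow> complex"
  assumes "continuous_on (cball 0 1) G" "G holomorphic_on ball 0 1" "z \<in> ball 0 1"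
  shows "((\<lambda>s. G (cis s) * cis s / (cis s - z)) has_integral 2 * pi * G z) {0..2 * pi}"
proof -
  have "((\<lambda>u. G u / (u - z)) has_contour_integral 2 * of_real pi * \<i> * G z) (circlepath 0 1)"
    using assms by (intro Cauchy_integral_circlepath) auto
  then have "((\<lambda>s. G (cis s) / (cis s - z) * \<i> * cis s) has_integral 2 * of_real pi * \<i> * G z)
      {0..2 * pi}"
    by (simp add: circlepath_def has_contour_integral_part_circlepath_iff)
  from has_integral_mult_right[OF this, of "- \<i>"] show ?thesis
    by (simp add: algebra_simps)
qed

text \<open>
  The Herglotz kernel splits as \<open>2 e / (e - z) - 1\<close> with \<open>e = cis s\<close>, so against \<open>h\<close> it is two
  instances of Cauchy's formula. Against the conjugate of \<open>g\<close> one conjugates the whole integrand: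
  on the circle the conjugate of the kernel equals \<open>(1 + cnj z * w) / (1 - cnj z * w)\<close>, which is
  holomorphic across the closed disc, so only the value at the origin survives. The dilation by
  \<open>r < 1\<close> makes both functions continuous up to the circle.
\<close>

lemma schwarz_formula:
  fixes h g :: "complex \<Rightarrow> complex"
  assumes h: "h holomorphic_on ball 0 1" and g: "g holomorphic_on ball 0 1"
    and r: "0 \<le> r" "r < 1" and z: "z \<in> ball 0 1"
  shows "((\<lambda>s. (cis s + z) / (cis s - z) * (h (of_real r * cis s) + cnj (g (of_real r * cis s))))
    has_integral 2 * pi * (2 * h (of_real r * z) - h 0 + cnj (g 0))) {0..2 * pi}"
proof -
  have rw: "of_real r * w \<in> ball 0 1" if "w \<in> cball 0 1" for w :: complex
  proof -
    have "r * cmod w \<le> r * 1" using that r by (intro mult_left_mono) auto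
    then show ?thesis using r by (simp add: norm_mult)
  qed
  have dilate: "continuous_on (cball 0 1) (\<lambda>w. k (of_real r * w))"
    "(\<lambda>w. k (of_real r * w)) holomorphic_on ball 0 1"
    if "k holomorphic_on ball 0 1" for k
  proof -
    show "continuous_on (cball 0 1) (\<lambda>w. k (of_real r * w))"
      by (rule continuous_on_compose2[OF holomorphic_on_imp_continuous_on[OF that]])
        (use rw in \<open>auto intro!: continuous_intros\<close>)
    have "(k \<circ> (\<lambda>w. of_real r * w)) holomorphic_on ball 0 1"
      by (rule holomorphic_on_compose_gen[OF _ that]) (use rw in \<open>auto intro!: holomorphic_intros\<close>)
    then show "(\<lambda>w. k (of_real r * w)) holomorphic_on ball 0 1" by (simp add: o_def)
  qed
  have ne: "cis s \<noteq> z" "cnj z * cis s \<noteq> 1" for s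
    using z by (auto simp: dest!: arg_cong[where f = cmod] simp: norm_mult)
  have nz: "1 - cnj z * w \<noteq> 0" if "w \<in> cball 0 1" for w
  proof
    assume "1 - cnj z * w = 0"
    then have "cmod z * cmod w = 1" by (metis complex_mod_cnj norm_mult norm_one right_minus_eq)
    moreover have "cmod z * cmod w \<le> cmod z * 1" using that by (intro mult_left_mono) auto
    ultimately show False using z by simp
  qed
  have "((\<lambda>s. 2 * (h (of_real r * cis s) * cis s / (cis s - z)) - h (of_real r * cis s) * cis s / (cis s - 0))
      has_integral 2 * (2 * pi * h (of_real r * z)) - 2 * pi * h (of_real r * 0)) {0..2 * pi}"
    by (intro has_integral_diff has_integral_mult_right cauchy_formula_unit_circle
        [where G = "\<lambda>w. h (of_real r * w)"] dilate h z) simp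
  also have "(\<lambda>s. 2 * (h (of_real r * cis s) * cis s / (cis s - z)) - h (of_real r * cis s) * cis s / (cis s - 0))
      = (\<lambda>s. (cis s + z) / (cis s - z) * h (of_real r * cis s))"
    using ne by (auto simp: fun_eq_iff field_simps)
  finally have 1: "((\<lambda>s. (cis s + z) / (cis s - z) * h (of_real r * cis s)) has_integral
      2 * pi * (2 * h (of_real r * z) - h 0)) {0..2 * pi}"
    by (simp add: algebra_simps)
  have "((\<lambda>s. (1 + cnj z * cis s) / (1 - cnj z * cis s) * g (of_real r * cis s) * cis s / (cis s - 0))
      has_integral 2 * pi * ((1 + cnj z * 0) / (1 - cnj z * 0) * g (of_real r * 0))) {0..2 * pi}"
    by (rule cauchy_formula_unit_circle
        [where G = "\<lambda>w. (1 + cnj z * w) / (1 - cnj z * w) * g (of_real r * w)"])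
      (use nz in \<open>auto intro!: continuous_intros holomorphic_intros dilate g\<close>)
  then have "((\<lambda>s. cnj ((1 + cnj z * cis s) / (1 - cnj z * cis s) * g (of_real r * cis s)))
      has_integral cnj (2 * pi * g 0)) {0..2 * pi}"
    by (intro has_integral_cnj[unfolded o_def, THEN iffD2]) simp
  also have "(\<lambda>s. cnj ((1 + cnj z * cis s) / (1 - cnj z * cis s) * g (of_real r * cis s)))
     = (\<lambda>s. (cis s + z) / (cis s - z) * cnj (g (of_real r * cis s)))"
  proof
    fix s
    have "(1 + z * cis (- s)) / (1 - z * cis (- s)) = (cis s + z) / (cis s - z)"
      using ne[of s] by (simp add: cis_inverse[symmetric] field_simps)
    then show "cnj ((1 + cnj z * cis s) / (1 - cnj z * cis s) * g (of_real r * cis s))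
        = (cis s + z) / (cis s - z) * cnj (g (of_real r * cis s))"
      by (simp add: cis_cnj flip: times_divide_eq_left)
  qed
  finally have 2: "((\<lambda>s. (cis s + z) / (cis s - z) * cnj (g (of_real r * cis s)))
      has_integral 2 * pi * cnj (g 0)) {0..2 * pi}" by simp
  from has_integral_add[OF 1 2] show ?thesis by (simp add: algebra_simps)
qed

section \<open>Limits of Stieltjes integrals\<close>

text \<open>
  By Tychonoff's theorem the family has a cluster point in a product of balls. Refining the filter
  by the neighbourhoods of that point turns clustering into convergence, at every index
  simultaneously. This takes the place of Helly's selection of a subsequence.
\<close>

lemma pointwise_cluster_filter:
  fixes m :: "'r \<Rightarrow> 'i \<Rightarrow> 'v::{heine_borel, real_normed_vector}"
  assumes "F \<noteq> bot" and bound: "\<And>i r. norm (m r i) \<le> B i"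
  obtains F' l where "F' \<le> F" "F' \<noteq> bot" "\<And>i. ((\<lambda>r. m r i) \<longlongrightarrow> l i) F'"
proof -
  define U where "U = PiE UNIV (\<lambda>i. cball (0::'v) (B i))"
  have "compactin (product_topology (\<lambda>i. euclidean) UNIV) U"
    unfolding U_def compactin_PiE by simp
  then have "compact U" by (simp add: euclidean_product_topology)
  moreover have "eventually (\<lambda>x. x \<in> U) (filtermap m F)"
    using bound by (simp add: U_def PiE_UNIV_domain eventually_filtermap)
  ultimately obtain l where l: "inf (nhds l) (filtermap m F) \<noteq> bot"
    using \<open>F \<noteq> bot\<close> unfolding compact_filter by (metis filtermap_bot_iff)
  define F' where "F' = inf F (filtercomap m (nhds l))"
  show thesis
  proof
    show "F' \<le> F" by (simp add: F'_def)
    show "F' \<noteq> bot"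
    proof
      assume "F' = bot"
      then have "eventually (\<lambda>_. False) F'" by simp
      then obtain P R where P: "eventually P F" and R: "eventually R (nhds l)"
        and PR: "\<And>r. P r \<Longrightarrow> R (m r) \<Longrightarrow> False"
        unfolding F'_def eventually_inf eventually_filtercomap by blast
      have "eventually (\<lambda>x. \<not> R x) (filtermap m F)"
        unfolding eventually_filtermap using P by eventually_elim (use PR in blast)
      with R have "eventually (\<lambda>_. False) (inf (nhds l) (filtermap m F))"
        unfolding eventually_inf by blast
      with l show False by (simp add: trivial_limit_def)
    qed
    show "((\<lambda>r. m r i) \<longlongrightarrow> l i) F'" for i
    proof -
      have "filterlim m (nhds l) F'"
        unfolding F'_def by (intro filterlim_inf[THEN iffD2] filterlim_filtercomap
          filterlim_mono[OF filterlim_filtercomap order_refl]) simp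
      from continuous_on_tendsto_compose[OF continuous_on_product_coordinates[of i] this]
      show ?thesis by simp
    qed
  qed
qed

text \<open>
  If the integrator is the primitive of \<open>q\<close>, then a Riemann--Stieltjes sum and the integral differ
  on each cell only by the oscillation of \<open>f\<close> weighted with \<open>q\<close>. The bound depends on \<open>q\<close> only
  through the total mass of a majorant, which is what makes it survive a limit in \<open>q\<close>.
\<close>

lemma stieltjes_sum_error:
  fixes f q :: "real \<Rightarrow> complex" and \<rho> :: "real \<Rightarrow> real"
  assumes f: "continuous_on {a..b} f" and q: "continuous_on {a..b} q"
    and \<rho>: "continuous_on {a..b} \<rho>" and dom: "\<And>s. s \<in> {a..b} \<Longrightarrow> cmod (q s) \<le> \<rho> s"
    and osc: "\<And>x s. x \<in> {a..b} \<Longrightarrow> s \<in> {a..b} \<Longrightarrow> dist x s < d \<Longrightarrow> cmod (f x - f s) \<le> \<epsilon>"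
    and p: "p tagged_division_of {a..b}" "(\<lambda>x. ball x d) fine p"
  shows "cmod ((\<Sum>(x, K)\<in>p. f x * (integral {a..Sup K} q - integral {a..Inf K} q))
      - integral {a..b} (\<lambda>s. f s * q s)) \<le> \<epsilon> * integral {a..b} \<rho>"
proof -
  have split: "integral {a..b} k = (\<Sum>(x, K)\<in>p. integral K k)"
    if "continuous_on {a..b} k" for k :: "real \<Rightarrow> 'c::euclidean_space"
    using integral_combine_tagged_division_topdown[of k a b p] that p
    by (simp add: integrable_continuous_interval)
  have cell: "cmod (f x * (integral {a..Sup K} q - integral {a..Inf K} q)
      - integral K (\<lambda>s. f s * q s)) \<le> integral K (\<lambda>s. \<epsilon> * \<rho> s)" if xK: "(x, K) \<in> p" for x K
  proof -
    have xin: "x \<in> K" and sub: "K \<subseteq> {a..b}"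
      using tagged_division_ofD(2,3)[OF p(1) xK] by auto
    obtain u v where K: "K = {u..v}"
      using tagged_division_ofD(4)[OF p(1) xK] by auto
    have uv: "a \<le> u" "u \<le> v" "v \<le> b" using xin sub K by auto
    have sub_uv: "{u..v} \<subseteq> {a..b}" using sub K by simp
    note on_K = continuous_on_subset[OF _ sub_uv]
    have cont_av: "continuous_on {a..v} q" using uv by (intro continuous_on_subset[OF q]) auto
    have "integral {a..v} q = integral {a..u} q + integral {u..v} q"
      using uv cont_av by (intro Henstock_Kurzweil_Integration.integral_combine[symmetric]
        integrable_continuous_interval) auto
    then have "f x * (integral {a..Sup K} q - integral {a..Inf K} q) - integral K (\<lambda>s. f s * q s)
        = f x * integral {u..v} q - integral {u..v} (\<lambda>s. f s * q s)"
      using uv by (simp add: K)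
    also have "\<dots> = integral {u..v} (\<lambda>s. f x * q s) - integral {u..v} (\<lambda>s. f s * q s)"
      by simp
    also have "\<dots> = integral {u..v} (\<lambda>s. f x * q s - f s * q s)"
      by (intro Henstock_Kurzweil_Integration.integral_diff[symmetric] integrable_continuous_interval
        continuous_intros on_K f q)
    also have "cmod \<dots> \<le> integral {u..v} (\<lambda>s. \<epsilon> * \<rho> s)"
    proof (rule integral_norm_bound_integral)
      show "(\<lambda>s. f x * q s - f s * q s) integrable_on {u..v}" "(\<lambda>s. \<epsilon> * \<rho> s) integrable_on {u..v}"
        by (intro integrable_continuous_interval continuous_intros on_K f q \<rho>)+
      show "cmod (f x * q s - f s * q s) \<le> \<epsilon> * \<rho> s" if s: "s \<in> {u..v}" for s
      proof -
        have sb: "s \<in> {a..b}" "x \<in> {a..b}" using s xin sub K by auto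
        have "K \<subseteq> ball x d" using p(2) xK by (auto simp: fine_def)
        then have "dist x s < d" using s K by auto
        then have "cmod (f x - f s) \<le> \<epsilon>" using osc sb by blast
        then have "cmod (f x - f s) * cmod (q s) \<le> \<epsilon> * \<rho> s"
          using dom[OF sb(1)] by (intro mult_mono) (auto intro: order_trans[OF norm_ge_zero])
        then show ?thesis by (simp add: norm_mult[symmetric] left_diff_distrib)
      qed
    qed
    finally show ?thesis by (simp add: K)
  qed
  have "(\<Sum>(x, K)\<in>p. f x * (integral {a..Sup K} q - integral {a..Inf K} q))
      - integral {a..b} (\<lambda>s. f s * q s)
      = (\<Sum>(x, K)\<in>p. f x * (integral {a..Sup K} q - integral {a..Inf K} q)
        - integral K (\<lambda>s. f s * q s))"
    by (subst split) (auto intro!: continuous_intros f q simp: sum_subtractf case_prod_unfold)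
  also have "cmod \<dots> \<le> (\<Sum>(x, K)\<in>p. integral K (\<lambda>s. \<epsilon> * \<rho> s))"
    by (rule sum_norm_le) (use cell in auto)
  also have "\<dots> = integral {a..b} (\<lambda>s. \<epsilon> * \<rho> s)"
    by (rule split[symmetric]) (intro continuous_intros \<rho>)
  finally show ?thesis by simp
qed

text \<open>
  Helly's second theorem, along an arbitrary filter: for integrators \<open>q r\<close> of bounded total mass
  the mesh needed for a given accuracy does not depend on \<open>r\<close>, so for a fixed tagged division one
  may let \<open>r\<close> tend to its limit first.
\<close>

lemma has_stieltjes_integral_limit:
  fixes f :: "real \<Rightarrow> complex" and q :: "'r \<Rightarrow> real \<Rightarrow> complex" and \<rho> :: "'r \<Rightarrow> real \<Rightarrow> real"
  assumes F: "F \<noteq> bot" and f: "continuous_on {a..b} f"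
    and q: "eventually (\<lambda>r. continuous_on {a..b} (q r)) F"
    and \<rho>: "eventually (\<lambda>r. continuous_on {a..b} (\<rho> r)) F"
    and dom: "eventually (\<lambda>r. \<forall>s\<in>{a..b}. cmod (q r s) \<le> \<rho> r s) F"
    and V: "eventually (\<lambda>r. integral {a..b} (\<rho> r) \<le> V) F"
    and g: "\<And>t. t \<in> {a..b} \<Longrightarrow> ((\<lambda>r. integral {a..t} (q r)) \<longlongrightarrow> g t) F"
    and I: "((\<lambda>r. integral {a..b} (\<lambda>s. f s * q r s)) \<longlongrightarrow> I) F"
  shows "has_stieltjes_integral f g I a b"
  unfolding has_stieltjes_integral_def
proof (intro allI impI)
  fix e :: real assume "e > 0"
  \<comment> \<open>The added 1 keeps the quotient meaningful when the mass bound vanishes.\<close>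
  define \<epsilon> where "\<epsilon> = e / (2 * (\<bar>V\<bar> + 1))"
  have \<epsilon>: "\<epsilon> > 0" "\<epsilon> * \<bar>V\<bar> < e"
    using \<open>e > 0\<close> by (auto simp: \<epsilon>_def field_simps intro!: add_nonneg_pos)
  have "uniformly_continuous_on {a..b} f"
    by (rule compact_uniformly_continuous[OF f]) simp
  then obtain d where "d > 0"
    and d: "\<And>x s. x \<in> {a..b} \<Longrightarrow> s \<in> {a..b} \<Longrightarrow> dist s x < d \<Longrightarrow> dist (f s) (f x) < \<epsilon>"
    unfolding uniformly_continuous_on_def using \<epsilon>(1) by metis
  have osc: "cmod (f x - f s) \<le> \<epsilon>" if "x \<in> {a..b}" "s \<in> {a..b}" "dist x s < d" for x s
    using d[of s x] that by (simp add: dist_norm)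
  show "\<exists>d>0. \<forall>p. p tagged_division_of {a..b} \<and> (\<lambda>x. ball x d) fine p \<longrightarrow>
      cmod ((\<Sum>(x, K)\<in>p. f x * (g (Sup K) - g (Inf K))) - I) < e"
  proof (intro exI[of _ d] conjI allI impI \<open>d > 0\<close>, elim conjE)
    fix p assume p: "p tagged_division_of {a..b}" "(\<lambda>x. ball x d) fine p"
    have ends: "Sup K \<in> {a..b}" "Inf K \<in> {a..b}" if xK: "(x, K) \<in> p" for x K
    proof -
      have "x \<in> K" "K \<subseteq> {a..b}" "\<exists>u v. K = {u..v}"
        using tagged_division_ofD(2-4)[OF p(1) xK] by auto
      then show "Sup K \<in> {a..b}" "Inf K \<in> {a..b}" by auto
    qed
    have lim: "((\<lambda>r. cmod ((\<Sum>(x, K)\<in>p. f x * (integral {a..Sup K} (q r) - integral {a..Inf K} (q r)))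
        - integral {a..b} (\<lambda>s. f s * q r s))) \<longlongrightarrow>
        cmod ((\<Sum>(x, K)\<in>p. f x * (g (Sup K) - g (Inf K))) - I)) F"
      unfolding case_prod_unfold
      by (intro tendsto_norm tendsto_diff tendsto_sum tendsto_mult tendsto_const g I)
        (use ends in auto)
    have "eventually (\<lambda>r. cmod ((\<Sum>(x, K)\<in>p. f x * (integral {a..Sup K} (q r) - integral {a..Inf K} (q r)))
        - integral {a..b} (\<lambda>s. f s * q r s)) \<le> \<epsilon> * \<bar>V\<bar>) F"
      using q \<rho> dom V
    proof eventually_elim
      case (elim r)
      then have "cmod ((\<Sum>(x, K)\<in>p. f x * (integral {a..Sup K} (q r) - integral {a..Inf K} (q r)))
        - integral {a..b} (\<lambda>s. f s * q r s)) \<le> \<epsilon> * integral {a..b} (\<rho> r)"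
        using stieltjes_sum_error[OF f _ _ _ osc p] by blast
      also have "\<dots> \<le> \<epsilon> * \<bar>V\<bar>" using elim \<epsilon>(1) by (intro mult_left_mono) auto
      finally show ?case .
    qed
    from tendsto_upperbound[OF lim this F] \<epsilon>(2)
    show "cmod ((\<Sum>(x, K)\<in>p. f x * (g (Sup K) - g (Inf K))) - I) < e" by simp
  qed
qed

section \<open>Sesquilinear forms and positive operators\<close>

text \<open>
  Scaling both arguments to norm one turns the quadratic bound, which is how the bound arises
  from positivity, into the bound \<open>2 * \<bar>C\<bar> * norm b * norm c\<close> that the operator needs.
\<close>

lemma sesquilinear_form_operator:
  fixes B :: "'b::complex_normed_vector \<Rightarrow> 'b \<Rightarrow> complex"
  assumes add: "\<And>b b' c. B (b + b') c = B b c + B b' c" "\<And>b c c'. B b (c + c') = B b c + B b c'"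
    and scale: "\<And>a b c. B (a *\<^sub>C b) c = a * B b c" "\<And>a b c. B b (a *\<^sub>C c) = cnj a * B b c"
    and bound: "\<And>b c. cmod (B b c) \<le> C * ((norm b)\<^sup>2 + (norm c)\<^sup>2)"
  shows "\<exists>A. \<forall>b c. pairing (cblinfun_apply A b) c = B b c"
proof -
  have scaleR: "B (t *\<^sub>R b) c = t *\<^sub>R B b c" "B b (t *\<^sub>R c) = t *\<^sub>R B b c" for t b c
    by (simp_all add: scaleR_scaleC scale scaleC_complex_def)
  have C: "0 \<le> C * (norm x)\<^sup>2" for x :: 'b
    using order_trans[OF norm_ge_zero bound[of x 0]] by simp
  have bd: "cmod (B b c) \<le> 2 * \<bar>C\<bar> * norm b * norm c" for b c
  proof (cases "b = 0 \<or> c = 0")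
    case True
    then show ?thesis using scaleR(1)[of 0 b c] scaleR(2)[of b 0 c] by auto
  next
    case False
    then have "B b c = (norm b * norm c) *\<^sub>R B (b /\<^sub>R norm b) (c /\<^sub>R norm c)"
      by (simp add: scaleR field_simps)
    then have "cmod (B b c) = norm b * norm c * cmod (B (b /\<^sub>R norm b) (c /\<^sub>R norm c))"
      by simp
    also have "\<dots> \<le> norm b * norm c * (2 * \<bar>C\<bar>)"
      using bound[of "b /\<^sub>R norm b" "c /\<^sub>R norm c"] False by (intro mult_left_mono) auto
    finally show ?thesis by (simp add: mult_ac)
  qed
  define e where "e b = Abs_conj_dual (Blinfun (B b))" for b
  have e: "pairing (e b) c = B b c" for b c
    unfolding e_def
    by (rule pairing_Abs_conj_dual)
      (auto intro!: bounded_linear_intro[where K = "2 * \<bar>C\<bar> * norm b"] simp: add scaleR scale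
        intro: order_trans[OF bd] simp: mult_ac)
  have "bounded_linear e"
  proof (rule bounded_linear_intro[where K = "2 * \<bar>C\<bar>"])
    show "norm (e b) \<le> norm b * (2 * \<bar>C\<bar>)" for b
      by (rule norm_conj_dual_bound) (use bd[of b] in \<open>auto simp: e mult_ac\<close>)
  qed (rule conj_dual_eqI, simp add: e add scaleR)+
  then have "cblinfun_apply (Abs_cblinfun (Blinfun e)) b = e b" for b
    by (rule cblinfun_apply_Abs_cblinfun) (auto intro!: conj_dual_eqI simp: e scale)
  then show ?thesis using e by metis
qed

lemma pairing_sum: "pairing f (\<Sum>i\<in>A. x i) = (\<Sum>i\<in>A. pairing f (x i))"
  by (induction A rule: infinite_finite_induct) auto

lemma sum_pairing: "pairing (\<Sum>i\<in>A. f i) x = (\<Sum>i\<in>A. pairing (f i) x)"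
  by (induction A rule: infinite_finite_induct) auto

lemma cblinfun_apply_sum: "cblinfun_apply A (\<Sum>i\<in>S. x i) = (\<Sum>i\<in>S. cblinfun_apply A (x i))"
  by (induction S rule: infinite_finite_induct) auto

lemma restricted_adjoint_symmetrized:
  "restricted_adjoint (A + restricted_adjoint A) = A + restricted_adjoint A"
  by (intro cblinfun_eqI conj_dual_eqI) (simp add: pairing_restricted_adjoint)

text \<open>
  The additive form of the Cauchy--Schwarz inequality, obtained by expanding the form at
  \<open>b - \<alpha> c\<close> with \<open>\<alpha>\<close> the phase of the off-diagonal entry. Being linear in the diagonal entries
  it can be integrated: it bounds the total variation of an off-diagonal integrator by the mass of
  two diagonal ones.
\<close>

lemma positive_op_Cauchy_Schwarz:
  assumes pos: "positive_op P" and sym: "restricted_adjoint P = P"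
  shows "cmod (pairing (cblinfun_apply P b) c)
    \<le> (Re (pairing (cblinfun_apply P b) b) + Re (pairing (cblinfun_apply P c) c)) / 2"
proof -
  let ?p = "\<lambda>b c. pairing (cblinfun_apply P b) c"
  have diag: "0 \<le> Re (?p x x)" "Im (?p x x) = 0" for x
    using pos by (auto simp: positive_op_def complex_nonneg_Reals_iff)
  define \<alpha> where "\<alpha> = sgn (?p b c)"
  have phase: "cnj \<alpha> * ?p b c = cmod (?p b c)"
  proof (cases "?p b c = 0")
    case False
    have "?p b c * cnj (?p b c) = of_real (cmod (?p b c)) * of_real (cmod (?p b c))"
      by (simp add: complex_norm_square[symmetric] power2_eq_square)
    then show ?thesis
      using False by (simp add: \<alpha>_def sgn_eq mult.commute)
  qed simp
  have "?p c b = cnj (?p b c)"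
    using pairing_restricted_adjoint[of P c b] sym by simp
  then have "\<alpha> * ?p c b = cnj (cnj \<alpha> * ?p b c)" by simp
  with phase
  have cross: "Re (cnj \<alpha> * ?p b c) = cmod (?p b c)" "Re (\<alpha> * ?p c b) = cmod (?p b c)"
    by (simp_all only: phase complex_cnj_complex_of_real Re_complex_of_real)
  have "cmod \<alpha> \<le> 1" by (simp add: \<alpha>_def norm_sgn)
  then have "(cmod \<alpha>)\<^sup>2 * Re (?p c c) \<le> 1 * Re (?p c c)"
    using diag by (intro mult_right_mono power_le_one) auto
  moreover have "Re (?p (b - \<alpha> *\<^sub>C c) (b - \<alpha> *\<^sub>C c))
      = Re (?p b b) - cmod (?p b c) - cmod (?p b c) + (cmod \<alpha>)\<^sup>2 * Re (?p c c)"
  proof -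
    have "?p (b - \<alpha> *\<^sub>C c) (b - \<alpha> *\<^sub>C c)
        = ?p b b - cnj \<alpha> * ?p b c - \<alpha> * ?p c b + of_real ((cmod \<alpha>)\<^sup>2) * ?p c c"
      unfolding complex_norm_square by (simp add: algebra_simps)
    then show ?thesis
      by (simp only: minus_complex.sel plus_complex.sel cross) simp
  qed
  ultimately show ?thesis using diag(1)[of "b - \<alpha> *\<^sub>C c"] by simp
qed

lemma has_integral_nonneg_Reals:
  fixes f :: "'n::euclidean_space \<Rightarrow> complex"
  assumes "(f has_integral I) S" "\<And>s. s \<in> S \<Longrightarrow> f s \<in> \<real>\<^sub>\<ge>\<^sub>0"
  shows "I \<in> \<real>\<^sub>\<ge>\<^sub>0"
proof -
  have parts: "0 \<le> Re (f s)" "Im (f s) = 0" if "s \<in> S" for s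
    using assms(2)[OF that] by (auto simp: complex_nonneg_Reals_iff)
  have "0 \<le> Re I"
    by (rule has_integral_nonneg[OF has_integral_Re[OF assms(1)]]) (rule parts)
  moreover have "((\<lambda>s. Im (f s)) has_integral 0) S"
    by (rule has_integral_is_0) (rule parts)
  then have "Im I = 0"
    by (rule has_integral_unique[OF has_integral_Im[OF assms(1)]])
  ultimately show ?thesis by (simp add: complex_nonneg_Reals_iff)
qed

section \<open>Densities on the circles of radius less than one\<close>

locale caratheodory_function =
  fixes \<phi> :: "complex \<Rightarrow> ('b::complex_normed_vector, 'b conj_dual) cblinfun"
  assumes holomorphic: "vector_holomorphic_on \<phi> (ball 0 1)"
    and positive: "z \<in> ball 0 1 \<Longrightarrow> positive_op (\<phi> z + restricted_adjoint (\<phi> z))"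
begin

definition form :: "complex \<Rightarrow> 'b \<Rightarrow> 'b \<Rightarrow> complex"
  where "form z b c = pairing (cblinfun_apply (\<phi> z) b) c"

text \<open>
  The boundary density of the Herglotz measure of the dilated function \<open>\<lambda>z. \<phi> (r * z)\<close>. The factor
  \<open>4 * pi\<close> combines the \<open>2 * pi\<close> of the mean over the circle with the \<open>2\<close> of the real part.
\<close>

definition density :: "real \<Rightarrow> real \<Rightarrow> 'b \<Rightarrow> 'b \<Rightarrow> complex"
  where "density r s b c = (form (r * cis s) b c + cnj (form (r * cis s) c b)) / (4 * pi)"

lemma form_holomorphic: "(\<lambda>z. form z b c) holomorphic_on ball 0 1"
  unfolding holomorphic_on_open[OF open_ball]
proof
  fix z :: complex assume "z \<in> ball 0 1"
  then obtain A where A: "(\<phi> has_derivative (\<lambda>h. h *\<^sub>C A)) (at z)"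
    using holomorphic unfolding vector_holomorphic_on_def by blast
  have "bounded_linear (\<lambda>T. pairing (cblinfun_apply T b) c)"
  proof (rule bounded_linear_intro[where K = "norm b * norm c"])
    show "norm (pairing (cblinfun_apply T b) c) \<le> norm T * (norm b * norm c)" for T
      using norm_pairing[of "cblinfun_apply T b" c]
        mult_right_mono[OF norm_cblinfun[of T b] norm_ge_zero[of c]] by (simp add: mult.assoc)
  qed auto
  from bounded_linear.has_derivative[OF this A]
  have "((\<lambda>z. form z b c) has_derivative (\<lambda>h. pairing (cblinfun_apply A b) c * h)) (at z)"
    by (simp add: form_def mult.commute)
  then show "\<exists>f'. ((\<lambda>z. form z b c) has_field_derivative f') (at z)"
    unfolding has_field_derivative_def by blast
qed

lemma form_radial_limit:
  assumes "z \<in> ball 0 1"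
  shows "((\<lambda>r. form (of_real r * z) b c) \<longlongrightarrow> form z b c) (at_left 1)"
proof -
  have "isCont (\<lambda>z. form z b c) z"
    using holomorphic_on_imp_continuous_on[OF form_holomorphic] assms
    by (simp add: continuous_on_eq_continuous_at)
  moreover have "((\<lambda>r. of_real r * z) \<longlongrightarrow> of_real 1 * z) (at_left 1)"
    by (intro tendsto_intros)
  ultimately show ?thesis by (auto intro: isCont_tendsto_compose)
qed

lemma circle_in_disc: "0 \<le> r \<Longrightarrow> r < 1 \<Longrightarrow> of_real r * cis s \<in> ball 0 1"
  by (simp add: norm_mult)

lemma density_eq: "density r s b c = pairing (cblinfun_apply
    (\<phi> (r * cis s) + restricted_adjoint (\<phi> (r * cis s))) b) c / (4 * pi)"
  by (simp add: density_def form_def pairing_restricted_adjoint)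

lemma density_sesquilinear:
  "density r s (b + b') c = density r s b c + density r s b' c"
  "density r s b (c + c') = density r s b c + density r s b c'"
  "density r s (a *\<^sub>C b) c = a * density r s b c"
  "density r s b (a *\<^sub>C c) = cnj a * density r s b c"
  by (simp_all add: density_eq add_divide_distrib del: cblinfun_apply_simps(2))

lemma cnj_density: "cnj (density r s b c) = density r s c b"
  by (simp add: density_def add.commute)

lemma density_nonneg:
  assumes "0 \<le> r" "r < 1"
  shows "density r s b b \<in> \<real>\<^sub>\<ge>\<^sub>0"
proof -
  have "pairing (cblinfun_apply (\<phi> (r * cis s) + restricted_adjoint (\<phi> (r * cis s))) b) b \<in> \<real>\<^sub>\<ge>\<^sub>0"
    using positive[OF circle_in_disc[OF assms]] by (auto simp: positive_op_def)
  then show ?thesis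
    unfolding density_eq by (simp add: complex_nonneg_Reals_iff)
qed

lemma density_dominated:
  assumes "0 \<le> r" "r < 1"
  shows "cmod (density r s b c) \<le> (Re (density r s b b) + Re (density r s c c)) / 2"
proof -
  let ?P = "\<phi> (r * cis s) + restricted_adjoint (\<phi> (r * cis s))"
  have "cmod (pairing (cblinfun_apply ?P b) c)
    \<le> (Re (pairing (cblinfun_apply ?P b) b) + Re (pairing (cblinfun_apply ?P c) c)) / 2"
    by (intro positive_op_Cauchy_Schwarz positive circle_in_disc assms restricted_adjoint_symmetrized)
  then have "cmod (pairing (cblinfun_apply ?P b) c) / (4 * pi)
    \<le> (Re (pairing (cblinfun_apply ?P b) b) + Re (pairing (cblinfun_apply ?P c) c)) / 2 / (4 * pi)"
    by (intro divide_right_mono) auto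
  then show ?thesis
    unfolding density_eq by (simp add: norm_divide add_divide_distrib del: cblinfun_apply_simps)
qed

lemma density_continuous:
  assumes "0 \<le> r" "r < 1"
  shows "continuous_on S (\<lambda>s. density r s b c)"
proof -
  have "continuous_on S (\<lambda>s. form (r * cis s) b c)" for b c
    by (rule continuous_on_compose2[OF holomorphic_on_imp_continuous_on[OF form_holomorphic]])
      (use circle_in_disc[OF assms] in \<open>auto intro!: continuous_intros simp del: mem_ball\<close>)
  then show ?thesis unfolding density_def by (intro continuous_intros) auto
qed

text \<open>
  The representation to be proved, for the dilated function: its measure has a continuous density.
\<close>

lemma schwarz_formula_density:
  assumes "0 \<le> r" "r < 1" "z \<in> ball 0 1"
  shows "((\<lambda>s. (cis s + z) / (cis s - z) * density r s b c) has_integral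
    form (of_real r * z) b c - (form 0 b c - cnj (form 0 c b)) / 2) {0..2 * pi}"
proof -
  have "((\<lambda>s. 1 / (4 * pi) * ((cis s + z) / (cis s - z)
      * (form (of_real r * cis s) b c + cnj (form (of_real r * cis s) c b)))) has_integral
      of_real (1 / (4 * pi)) * (2 * pi * (2 * form (of_real r * z) b c - form 0 b c + cnj (form 0 c b)))) {0..2 * pi}"
    using has_integral_mult_right[OF schwarz_formula[OF form_holomorphic form_holomorphic assms],
      of "of_real (1 / (4 * pi))"] by simp
  then show ?thesis
    by (rule has_integral_eq_rhs[OF has_integral_eq, rotated])
      (simp_all add: density_def field_simps)
qed

lemma density_total:
  assumes "0 \<le> r" "r < 1"
  shows "((\<lambda>s. density r s b c) has_integral (form 0 b c + cnj (form 0 c b)) / 2) {0..2 * pi}"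
  using schwarz_formula_density[OF assms, of 0 b c] by (simp add: field_simps)

section \<open>Distribution functions of the dilated measures\<close>

definition mass :: "real \<Rightarrow> real \<Rightarrow> 'b \<Rightarrow> 'b \<Rightarrow> complex"
  where "mass r t b c = integral {0..t} (\<lambda>s. density r s b c)"

lemma density_integrable:
  assumes "0 \<le> r" "r < 1"
  shows "(\<lambda>s. density r s b c) integrable_on {u..v}"
  by (intro integrable_continuous_interval density_continuous assms)

lemma mass_sesquilinear:
  assumes "0 \<le> r" "r < 1"
  shows "mass r t (b + b') c = mass r t b c + mass r t b' c"
    "mass r t b (c + c') = mass r t b c + mass r t b c'"
    "mass r t (a *\<^sub>C b) c = a * mass r t b c"
    "mass r t b (a *\<^sub>C c) = cnj a * mass r t b c"
  unfolding mass_def density_sesquilinear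
  by (simp_all add: Henstock_Kurzweil_Integration.integral_add density_integrable[OF assms])

lemma mass_increasing:
  assumes "0 \<le> r" "r < 1" "0 \<le> u" "u \<le> v"
  shows "mass r v b b - mass r u b b \<in> \<real>\<^sub>\<ge>\<^sub>0"
proof -
  have "mass r v b b = mass r u b b + integral {u..v} (\<lambda>s. density r s b b)"
    unfolding mass_def using assms
    by (intro Henstock_Kurzweil_Integration.integral_combine[symmetric] density_integrable)
  moreover have "integral {u..v} (\<lambda>s. density r s b b) \<in> \<real>\<^sub>\<ge>\<^sub>0"
    by (rule has_integral_nonneg_Reals[OF integrable_integral[OF density_integrable]])
      (use assms in \<open>auto intro: density_nonneg\<close>)
  ultimately show ?thesis by simp
qed

text \<open>
  Half the sum of the total masses of the diagonal measures at \<open>b\<close> and at \<open>c\<close>. By the mean value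
  property these masses are values at the origin and do not depend on the radius.
\<close>

definition mass_bound :: "'b \<Rightarrow> 'b \<Rightarrow> real"
  where "mass_bound b c = (Re (form 0 b b) + Re (form 0 c c)) / 2"

lemma density_dominated_total:
  assumes "0 \<le> r" "r < 1"
  shows "((\<lambda>s. (Re (density r s b b) + Re (density r s c c)) / 2) has_integral mass_bound b c)
    {0..2 * pi}"
proof -
  have "((\<lambda>s. Re (density r s b b)) has_integral Re (form 0 b b)) {0..2 * pi}" for b
    using has_integral_Re[OF density_total[OF assms, of b b]] by simp
  from has_integral_divide[OF has_integral_add[OF this[of b] this[of c]], of 2]
  show ?thesis by (simp add: mass_bound_def)
qed

lemma mass_dominated:
  assumes "0 \<le> r" "r < 1" "t \<in> {0..2 * pi}"
  shows "cmod (mass r t b c) \<le> mass_bound b c"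
proof -
  let ?\<rho> = "\<lambda>s. (Re (density r s b b) + Re (density r s c c)) / 2"
  have cont: "continuous_on S ?\<rho>" for S
    by (intro continuous_intros density_continuous assms) auto
  have nonneg: "0 \<le> ?\<rho> s" for s
    using order_trans[OF norm_ge_zero density_dominated[OF assms(1,2)]] .
  have "cmod (mass r t b c) \<le> integral {0..t} ?\<rho>"
    unfolding mass_def
    by (intro integral_norm_bound_integral density_integrable density_dominated
      integrable_continuous_interval cont assms)
  also have "\<dots> \<le> integral {0..2 * pi} ?\<rho>"
    using assms(3) nonneg by (intro integral_subset_le integrable_continuous_interval cont) auto
  also have "\<dots> = mass_bound b c"
    using density_dominated_total[OF assms(1,2)] by (rule integral_unique)
  finally show ?thesis .
qed

lemma mass_bound_le: "mass_bound b c \<le> norm (\<phi> 0) * ((norm b)\<^sup>2 + (norm c)\<^sup>2)"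
proof -
  have "Re (form 0 x x) \<le> norm (\<phi> 0) * (norm x)\<^sup>2" for x
  proof -
    have "Re (form 0 x x) \<le> norm (cblinfun_apply (\<phi> 0) x) * norm x"
      unfolding form_def by (rule order_trans[OF complex_Re_le_cmod norm_pairing])
    also have "\<dots> \<le> norm (\<phi> 0) * norm x * norm x"
      by (intro mult_right_mono norm_cblinfun) simp
    finally show ?thesis by (simp add: power2_eq_square mult.assoc)
  qed
  from this[of b] this[of c] have "mass_bound b c \<le> norm (\<phi> 0) * ((norm b)\<^sup>2 + (norm c)\<^sup>2) / 2"
    by (simp add: mass_bound_def algebra_simps)
  also have "\<dots> \<le> norm (\<phi> 0) * ((norm b)\<^sup>2 + (norm c)\<^sup>2)" by simp
  finally show ?thesis .
qed

text \<open>
  The distribution functions of the dilated measures are bounded uniformly in the radius, hence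
  converge pointwise along some filter finer than \<open>r \<rightarrow> 1\<close>. Sesquilinearity and the bound pass to
  the limit, so at each \<open>t\<close> the limit form is an operator.
\<close>

lemma limit_mass:
  obtains F and M :: "real \<Rightarrow> ('b, 'b conj_dual) cblinfun" where "F \<le> at_left (1::real)" "F \<noteq> bot"
    "\<And>t b c. t \<in> {0..2 * pi} \<Longrightarrow>
      ((\<lambda>r. mass r t b c) \<longlongrightarrow> pairing (cblinfun_apply (M t) b) c) F"
proof -
  \<comment> \<open>Cutting off outside the admissible radii and times makes the bound hold for every index.\<close>
  define m where "m r = (\<lambda>(t, b, c). if 0 \<le> r \<and> r < 1 \<and> t \<in> {0..2 * pi} then mass r t b c else 0)" for r
  have "0 \<le> mass_bound b c" for b c
    using order_trans[OF norm_ge_zero mass_dominated[of 0 0 b c]] by simp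
  then have m_bound: "norm (m r i) \<le> (case i of (t, b, c) \<Rightarrow> mass_bound b c)" for r i
    using mass_dominated by (auto simp: m_def split: prod.splits)
  have "at_left (1::real) \<noteq> bot" by simp
  from pointwise_cluster_filter[where m = m, OF this m_bound] obtain F l
    where F: "F \<le> at_left 1" "F \<noteq> bot" and l: "\<And>i. ((\<lambda>r. m r i) \<longlongrightarrow> l i) F"
    by blast
  have "eventually (\<lambda>r. r \<in> {0<..<1}) (at_left (1::real))"
    by (rule eventually_at_left_real) simp
  then have r: "eventually (\<lambda>r. 0 \<le> r \<and> r < 1) F"
    using F(1) by (auto simp: le_filter_def elim!: eventually_mono)
  have lim: "((\<lambda>r. mass r t b c) \<longlongrightarrow> l (t, b, c)) F" if "t \<in> {0..2 * pi}" for t b c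
    by (rule Lim_transform_eventually[OF l]) (use r that in \<open>auto simp: m_def elim!: eventually_mono\<close>)
  have "\<exists>A. \<forall>b c. pairing (cblinfun_apply A b) c = l (t, b, c)" if t: "t \<in> {0..2 * pi}" for t
  proof (rule sesquilinear_form_operator)
    have eq: "l (t, b, c) = L"
      if "(f \<longlongrightarrow> L) F" "\<And>r. 0 \<le> r \<Longrightarrow> r < 1 \<Longrightarrow> f r = mass r t b c" for f L b c
      by (rule tendsto_unique[OF F(2) lim[OF t] Lim_transform_eventually[OF that(1)]])
        (use r that(2) in \<open>auto elim!: eventually_mono\<close>)
    show "l (t, b + b', c) = l (t, b, c) + l (t, b', c)" for b b' c
      by (rule eq[OF tendsto_add[OF lim[OF t] lim[OF t]]]) (simp add: mass_sesquilinear)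
    show "l (t, b, c + c') = l (t, b, c) + l (t, b, c')" for b c c'
      by (rule eq[OF tendsto_add[OF lim[OF t] lim[OF t]]]) (simp add: mass_sesquilinear)
    show "l (t, a *\<^sub>C b, c) = a * l (t, b, c)" for a b c
      by (rule eq[OF tendsto_mult[OF tendsto_const lim[OF t]]]) (simp add: mass_sesquilinear)
    show "l (t, b, a *\<^sub>C c) = cnj a * l (t, b, c)" for a b c
      by (rule eq[OF tendsto_mult[OF tendsto_const lim[OF t]]]) (simp add: mass_sesquilinear)
    show "cmod (l (t, b, c)) \<le> norm (\<phi> 0) * ((norm b)\<^sup>2 + (norm c)\<^sup>2)" for b c
    proof -
      have "cmod (l (t, b, c)) \<le> mass_bound b c"
        by (rule tendsto_upperbound[OF tendsto_norm[OF lim[OF t]] _ F(2)])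
          (use r mass_dominated[OF _ _ t] in \<open>auto elim!: eventually_mono\<close>)
      with mass_bound_le show ?thesis by (rule order_trans[rotated])
    qed
  qed
  then obtain M where "\<And>t b c. t \<in> {0..2 * pi} \<Longrightarrow> pairing (cblinfun_apply (M t) b) c = l (t, b, c)"
    by metis
  with that[OF F, of M] lim show thesis by simp
qed

section \<open>The Herglotz representation\<close>

theorem herglotz_representation:
  "\<exists>M D. increasing_op_on {0..2 * pi} M \<and> D + restricted_adjoint D = 0 \<and>
    (\<forall>z\<in>ball 0 1. \<exists>I.
      has_weak_stieltjes_integral (\<lambda>t. (exp (\<i> * t) + z) / (exp (\<i> * t) - z)) M I 0 (2 * pi)
      \<and> \<phi> z = D + I)"
proof -
  obtain F and M :: "real \<Rightarrow> ('b, 'b conj_dual) cblinfun"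
    where F: "F \<le> at_left (1::real)" "F \<noteq> bot"
    and lim: "\<And>t b c. t \<in> {0..2 * pi} \<Longrightarrow>
      ((\<lambda>r. mass r t b c) \<longlongrightarrow> pairing (cblinfun_apply (M t) b) c) F"
    using limit_mass by blast
  have "eventually (\<lambda>r. r \<in> {0<..<1}) (at_left (1::real))"
    by (rule eventually_at_left_real) simp
  then have r: "eventually (\<lambda>r. 0 \<le> r \<and> r < 1) F"
    using F(1) by (auto simp: le_filter_def elim!: eventually_mono)
  \<comment> \<open>At the origin the kernel is 1 and the integral is symmetric, so \<open>D\<close> must be the skew part of \<open>\<phi> 0\<close>.\<close>
  define D where "D = (1 / 2) *\<^sub>R (\<phi> 0 - restricted_adjoint (\<phi> 0))"
  have D: "pairing (cblinfun_apply D b) c = (form 0 b c - cnj (form 0 c b)) / 2" for b c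
    by (simp add: D_def form_def pairing_restricted_adjoint scaleR_conv_of_real)
  have "D + restricted_adjoint D = 0"
    by (intro cblinfun_eqI conj_dual_eqI) (simp add: D pairing_restricted_adjoint field_simps)
  moreover have "increasing_op_on {0..2 * pi} M"
    unfolding increasing_op_on_def positive_op_def
  proof (intro ballI impI allI)
    fix u v b assume uv: "u \<in> {0..2 * pi}" "v \<in> {0..2 * pi}" "u \<le> v"
    show "pairing (cblinfun_apply (M v - M u) b) b \<in> \<real>\<^sub>\<ge>\<^sub>0"
    proof (rule Lim_in_closed_set[OF closed_nonneg_Reals_complex _ F(2)])
      show "((\<lambda>r. mass r v b b - mass r u b b) \<longlongrightarrow> pairing (cblinfun_apply (M v - M u) b) b) F"
        using uv by (auto intro!: tendsto_diff lim)
      show "eventually (\<lambda>r. mass r v b b - mass r u b b \<in> \<real>\<^sub>\<ge>\<^sub>0) F"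
        using r by eventually_elim (use uv in \<open>auto intro: mass_increasing\<close>)
    qed
  qed
  moreover have "has_weak_stieltjes_integral (\<lambda>t. (exp (\<i> * t) + z) / (exp (\<i> * t) - z))
      M (\<phi> z - D) 0 (2 * pi)" if z: "z \<in> ball 0 1" for z
    unfolding has_weak_stieltjes_integral_def cis_conv_exp[symmetric]
  proof (intro allI, rule has_stieltjes_integral_limit[OF F(2), where V = "mass_bound b c" for b c])
    fix b c
    show "continuous_on {0..2 * pi} (\<lambda>t. (cis t + z) / (cis t - z))"
      using z by (auto intro!: continuous_intros dest!: arg_cong[where f = cmod])
    show "\<forall>\<^sub>F r in F. continuous_on {0..2 * pi} (\<lambda>s. density r s b c)"
      using r by eventually_elim (auto intro: density_continuous)
    show "\<forall>\<^sub>F r in F. continuous_on {0..2 * pi} (\<lambda>s. (Re (density r s b b) + Re (density r s c c)) / 2)"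
      using r by eventually_elim (auto intro!: continuous_intros density_continuous)
    show "\<forall>\<^sub>F r in F. \<forall>s\<in>{0..2 * pi}. cmod (density r s b c)
        \<le> (Re (density r s b b) + Re (density r s c c)) / 2"
      using r by eventually_elim (intro ballI density_dominated; simp)
    show "\<forall>\<^sub>F r in F. integral {0..2 * pi} (\<lambda>s. (Re (density r s b b) + Re (density r s c c)) / 2)
        \<le> mass_bound b c"
      using r by eventually_elim (rule eq_refl, rule integral_unique, rule density_dominated_total; simp)
    show "((\<lambda>r. integral {0..t} (\<lambda>s. density r s b c)) \<longlongrightarrow> pairing (cblinfun_apply (M t) b) c) F"
      if "t \<in> {0..2 * pi}" for t
      using lim[OF that] by (simp add: mass_def)
    have "((\<lambda>r. form (of_real r * z) b c - (form 0 b c - cnj (form 0 c b)) / 2) \<longlongrightarrow>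
        pairing (cblinfun_apply (\<phi> z - D) b) c) F"
      using tendsto_mono[OF F(1) form_radial_limit[OF z]]
      by (auto intro!: tendsto_diff simp: D) (simp add: form_def)
    then show "((\<lambda>r. integral {0..2 * pi} (\<lambda>s. (cis s + z) / (cis s - z) * density r s b c)) \<longlongrightarrow>
        pairing (cblinfun_apply (\<phi> z - D) b) c) F"
      by (rule Lim_transform_eventually)
        (use r in eventually_elim, intro integral_unique[symmetric] schwarz_formula_density z; simp)
  qed
  moreover have "\<phi> z = D + (\<phi> z - D)" for z by simp
  ultimately show ?thesis by blast
qed

section \<open>Positivity of the kernel\<close>

text \<open>
  On the unit circle the sum of two Herglotz kernels is, up to the factor \<open>2 * (1 - z * cnj w)\<close>, a
  product of a function of \<open>z\<close> and one of \<open>w\<close>. This is where the denominator of the kernel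
  comes from.
\<close>

lemma cauchy_kernel_factorization:
  assumes z: "z \<in> ball 0 1" and w: "w \<in> ball 0 1"
  shows "1 / (2 * (1 - z * cnj w)) * ((cis s + z) / (cis s - z) + cnj ((cis s + w) / (cis s - w)))
    = cnj (1 / (cnj (cis s) - cnj z)) * (1 / (cnj (cis s) - cnj w))"
proof -
  have ne: "cis s \<noteq> z" "cnj (cis s) \<noteq> cnj w"
    using z w by (auto dest!: arg_cong[where f = cmod])
  have "cmod (z * cnj w) < 1"
    using z w by (simp add: norm_mult) (metis mult_strict_mono' norm_ge_zero mult_1)
  then have nz: "1 - z * cnj w \<noteq> 0" by auto
  have unit: "cis s * cnj (cis s) = 1" by (simp add: cis_cnj cis_mult)
  have "(cis s + z) / (cis s - z) + (cnj (cis s) + cnj w) / (cnj (cis s) - cnj w)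
      = (2 * (cis s * cnj (cis s)) - 2 * (z * cnj w)) / ((cis s - z) * (cnj (cis s) - cnj w))"
    using ne by (simp add: field_simps)
  also have "\<dots> = 2 * (1 - z * cnj w) / ((cis s - z) * (cnj (cis s) - cnj w))"
    by (simp add: unit)
  finally show ?thesis using nz by simp
qed

text \<open>
  Each entry of the kernel of the dilated function is an integral of the density, with the two
  Cauchy factors absorbed into the two vectors. The factor with \<open>z\<close> enters conjugated because the
  form is anti-linear in its second argument.
\<close>

lemma dilated_kernel_integral:
  assumes r: "0 \<le> r" "r < 1" and z: "z \<in> ball 0 1" and w: "w \<in> ball 0 1"
  shows "((\<lambda>s. density r s ((1 / (cnj (cis s) - cnj w)) *\<^sub>C b) ((1 / (cnj (cis s) - cnj z)) *\<^sub>C c))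
    has_integral 1 / (2 * (1 - z * cnj w)) * (form (of_real r * z) b c + cnj (form (of_real r * w) c b)))
    {0..2 * pi}"
proof -
  have "((\<lambda>s. cnj ((cis s + w) / (cis s - w) * density r s c b)) has_integral
      cnj (form (of_real r * w) c b - (form 0 c b - cnj (form 0 b c)) / 2)) {0..2 * pi}"
    using schwarz_formula_density[OF r w, of c b] has_integral_cnj by (force simp: o_def)
  from has_integral_mult_right[OF has_integral_add[OF schwarz_formula_density[OF r z, of b c] this],
      of "1 / (2 * (1 - z * cnj w))"]
  have "((\<lambda>s. 1 / (2 * (1 - z * cnj w)) * ((cis s + z) / (cis s - z) * density r s b c
        + cnj ((cis s + w) / (cis s - w)) * density r s b c)) has_integral
      1 / (2 * (1 - z * cnj w)) * (form (of_real r * z) b c + cnj (form (of_real r * w) c b)))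
      {0..2 * pi}"
    by (simp add: cnj_density diff_divide_distrib)
  also have "(\<lambda>s. 1 / (2 * (1 - z * cnj w)) * ((cis s + z) / (cis s - z) * density r s b c
        + cnj ((cis s + w) / (cis s - w)) * density r s b c))
      = (\<lambda>s. density r s ((1 / (cnj (cis s) - cnj w)) *\<^sub>C b) ((1 / (cnj (cis s) - cnj z)) *\<^sub>C c))"
  proof
    fix s
    show "1 / (2 * (1 - z * cnj w)) * ((cis s + z) / (cis s - z) * density r s b c
        + cnj ((cis s + w) / (cis s - w)) * density r s b c)
      = density r s ((1 / (cnj (cis s) - cnj w)) *\<^sub>C b) ((1 / (cnj (cis s) - cnj z)) *\<^sub>C c)"
      unfolding density_sesquilinear distrib_right[symmetric] mult.assoc[symmetric]
        cauchy_kernel_factorization[OF z w] by (simp only: mult_ac)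
  qed
  finally show ?thesis .
qed

text \<open>
  For the dilated function the quadratic form of the kernel is an integral of diagonal values of the
  density, taken at the vectors \<open>\<Sum>i<n. b i / (cnj e - cnj (z i))\<close> with \<open>e = cis s\<close>. Letting
  \<open>r \<rightarrow> 1\<close> only involves values of \<open>\<phi>\<close> inside the disc.
\<close>

theorem positive_kernel:
  "positive_kernel_on (ball 0 1)
    (\<lambda>z w. (1 / (2 * (1 - z * cnj w))) *\<^sub>C (\<phi> z + restricted_adjoint (\<phi> w)))"
  unfolding positive_kernel_on_def
proof (intro allI impI)
  fix n :: nat and z :: "nat \<Rightarrow> complex" and b :: "nat \<Rightarrow> 'b"
  assume z: "\<forall>i<n. z i \<in> ball 0 1"
  let ?\<kappa> = "\<lambda>r. \<Sum>i<n. \<Sum>j<n. 1 / (2 * (1 - z i * cnj (z j)))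
    * (form (of_real r * z i) (b j) (b i) + cnj (form (of_real r * z j) (b i) (b j)))"
  let ?K = "\<Sum>i<n. \<Sum>j<n. pairing (cblinfun_apply ((1 / (2 * (1 - z i * cnj (z j)))) *\<^sub>C
    (\<phi> (z i) + restricted_adjoint (\<phi> (z j)))) (b j)) (b i)"
  have K: "?K = (\<Sum>i<n. \<Sum>j<n. 1 / (2 * (1 - z i * cnj (z j)))
    * (form (z i) (b j) (b i) + cnj (form (z j) (b i) (b j))))"
    by (simp add: form_def pairing_restricted_adjoint)
  show "?K \<in> \<real>\<^sub>\<ge>\<^sub>0"
  proof (rule Lim_in_closed_set[OF closed_nonneg_Reals_complex])
    show "(?\<kappa> \<longlongrightarrow> ?K) (at_left 1)"
      unfolding K by (intro tendsto_sum tendsto_mult tendsto_add tendsto_cnj tendsto_const form_radial_limit)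
        (use z in auto)
    have "eventually (\<lambda>r. r \<in> {0<..<1}) (at_left (1::real))"
      by (rule eventually_at_left_real) simp
    then show "eventually (\<lambda>r. ?\<kappa> r \<in> \<real>\<^sub>\<ge>\<^sub>0) (at_left 1)"
    proof eventually_elim
      case (elim r)
      then have r: "0 \<le> r" "r < 1" by auto
      let ?c = "\<lambda>s i. (1 / (cnj (cis s) - cnj (z i))) *\<^sub>C b i"
      have "((\<lambda>s. \<Sum>i<n. \<Sum>j<n. density r s (?c s j) (?c s i)) has_integral ?\<kappa> r) {0..2 * pi}"
        by (intro has_integral_sum dilated_kernel_integral r) (use z in auto)
      then show ?case
      proof (rule has_integral_nonneg_Reals)
        fix s
        have "(\<Sum>i<n. \<Sum>j<n. density r s (?c s j) (?c s i))
            = density r s (\<Sum>j<n. ?c s j) (\<Sum>i<n. ?c s i)"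
          unfolding density_eq by (simp only: pairing_sum cblinfun_apply_sum sum_pairing sum_divide_distrib)
        then show "(\<Sum>i<n. \<Sum>j<n. density r s (?c s j) (?c s i)) \<in> \<real>\<^sub>\<ge>\<^sub>0"
          using density_nonneg[OF r] by simp
      qed
    qed
  qed simp
qed

end

section \<open>The integral representation and the positive kernel of a Caratheodory function\<close>

theorem theorem5p5:
  fixes \<phi> :: "complex \<Rightarrow> ('b::complex_banach, 'b conj_dual) cblinfun"
  assumes "separable_space (euclidean :: 'b topology)"
    and "vector_holomorphic_on \<phi> (ball 0 1)"
    and "\<forall>z\<in>ball 0 1. positive_op (\<phi> z + restricted_adjoint (\<phi> z))"
  shows "(\<exists>M D. increasing_op_on {0..2 * pi} M \<and> D + restricted_adjoint D = 0 \<and>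
      (\<forall>z\<in>ball 0 1. \<exists>I.
        has_weak_stieltjes_integral (\<lambda>t. (exp (\<i> * t) + z) / (exp (\<i> * t) - z)) M I 0 (2 * pi)
        \<and> \<phi> z = D + I)) \<and>
    positive_kernel_on (ball 0 1)
      (\<lambda>z w. (1 / (2 * (1 - z * cnj w))) *\<^sub>C (\<phi> z + restricted_adjoint (\<phi> w)))"
proof -
  interpret caratheodory_function \<phi>
    using assms(2,3) by unfold_locales auto
  show ?thesis using herglotz_representation positive_kernel by blast
qed

end
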